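(* Let $G=(V,E)$ be a graph and let $D$ be the maximum degree of its blocks (the maximum, over all blocks $B$ of $G$, of the maximum degree of the graph $B$). Then $G$ is $(D+1)$-choosable, and $(D+1)$-LISTCOL can be solved in $O(|V|+|E|)$.
   Context: All graphs are finite and simple. A graph $G=(V,E)$ is $\ell$-choosable if for every assignment of lists $L(v)$ of colors with $|L(v)|=\ell$ for all $v\in V$, there is a list coloring, i.e. a proper vertex coloring $c$ of $G$ with $c(v)\in L(v)$ for all $v\in V$. $\ell$-LISTCOL is the following decision problem: given a graph $G=(V,E)$ and an assignment of lists $L(v)$ with $|L(v)|=\ell$ for all $v\in V$ (with no limitation on the total number of available colors), decide whether there is a list coloring. A cut vertex of a graph is a vertex whose removal disconnects the graph; a block of a graph is a maximal connected subgraph without cut vertex. *)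

theory Defs
  imports Complex_Main
begin

section \<open>Graphs, blocks, list colourings\<close>

record 'a ugraph =
  verts :: "'a set"
  edges :: "'a set set"

definition finite_simple_graph :: "'a ugraph \<Rightarrow> bool" where
  "finite_simple_graph G \<longleftrightarrow>
     finite (verts G) \<and> (\<forall>e\<in>edges G. e \<subseteq> verts G \<and> card e = 2)"

definition subgraph :: "'a ugraph \<Rightarrow> 'a ugraph \<Rightarrow> bool" where
  "subgraph H G \<longleftrightarrow>
     finite_simple_graph H \<and> verts H \<subseteq> verts G \<and> edges H \<subseteq> edges G"

definition degree :: "'a ugraph \<Rightarrow> 'a \<Rightarrow> nat" where
  "degree G v = card {e \<in> edges G. v \<in> e}"

definition max_degree :: "'a ugraph \<Rightarrow> nat" where
  "max_degree G = Max (degree G ` verts G)"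

definition reachable :: "'a ugraph \<Rightarrow> 'a \<Rightarrow> 'a \<Rightarrow> bool" where
  "reachable G u v \<longleftrightarrow> (u, v) \<in> {(x, y). {x, y} \<in> edges G}\<^sup>*"

definition connected_graph :: "'a ugraph \<Rightarrow> bool" where
  "connected_graph G \<longleftrightarrow>
     verts G \<noteq> {} \<and> (\<forall>u\<in>verts G. \<forall>v\<in>verts G. reachable G u v)"

definition remove_vertex :: "'a ugraph \<Rightarrow> 'a \<Rightarrow> 'a ugraph" where
  "remove_vertex G v = \<lparr>verts = verts G - {v}, edges = {e \<in> edges G. v \<notin> e}\<rparr>"

text \<open>Removing \<open>v\<close> disconnects the graph if it separates two other vertices that were connected
  before.  In particular the vertex of a one-vertex graph is not a cut vertex, so isolated
  vertices are blocks.\<close>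

definition cut_vertex :: "'a ugraph \<Rightarrow> 'a \<Rightarrow> bool" where
  "cut_vertex G v \<longleftrightarrow> v \<in> verts G \<and>
     (\<exists>x\<in>verts G - {v}. \<exists>y\<in>verts G - {v}.
        reachable G x y \<and> \<not> reachable (remove_vertex G v) x y)"

definition connected_without_cut_vertex :: "'a ugraph \<Rightarrow> bool" where
  "connected_without_cut_vertex H \<longleftrightarrow> connected_graph H \<and> (\<forall>v. \<not> cut_vertex H v)"

definition block :: "'a ugraph \<Rightarrow> 'a ugraph \<Rightarrow> bool" where
  "block G B \<longleftrightarrow> subgraph B G \<and> connected_without_cut_vertex B \<and>
     (\<forall>H. subgraph H G \<and> connected_without_cut_vertex H \<and> subgraph B H \<longrightarrow> H = B)"

text \<open>On \<open>nat\<close>, \<open>Sup\<close> of a finite nonempty set is its maximum; the graph without vertices has no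
  blocks and gets the value \<open>Sup {} = 0\<close>.\<close>

definition max_block_degree :: "'a ugraph \<Rightarrow> nat" where
  "max_block_degree G = Sup {max_degree B |B. block G B}"

text \<open>Colours are natural numbers: a list assignment of a finite graph involves only finitely
  many colours, and their number is not bounded here.\<close>

definition list_assignment :: "'a ugraph \<Rightarrow> nat \<Rightarrow> ('a \<Rightarrow> nat set) \<Rightarrow> bool" where
  "list_assignment G l L \<longleftrightarrow> (\<forall>v\<in>verts G. finite (L v) \<and> card (L v) = l)"

definition list_coloring :: "'a ugraph \<Rightarrow> ('a \<Rightarrow> nat set) \<Rightarrow> ('a \<Rightarrow> nat) \<Rightarrow> bool" where
  "list_coloring G L c \<longleftrightarrow>
     (\<forall>v\<in>verts G. c v \<in> L v) \<and> (\<forall>u v. {u, v} \<in> edges G \<longrightarrow> c u \<noteq> c v)"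

definition choosable :: "'a ugraph \<Rightarrow> nat \<Rightarrow> bool" where
  "choosable G l \<longleftrightarrow> (\<forall>L. list_assignment G l L \<longrightarrow> (\<exists>c. list_coloring G L c))"


section \<open>A unit-cost random access machine\<close>

text \<open>The memory consists of arrays of natural numbers, and \<open>s a i\<close> is the content of cell \<open>i\<close> of
  array \<open>a\<close>.  Array names are constants of the program, so a program uses a fixed number of
  arrays (scalar variables are cells with constant index), while cells are addressed by computed
  indices.  The arithmetic operations are addition and truncated subtraction; multiplication is
  not primitive.  As expressions have a size fixed by the program, charging one step per
  assignment or test agrees with charging every elementary operation up to a constant
  factor.\<close>

type_synonym state = "nat \<Rightarrow> nat \<Rightarrow> nat"

datatype aexp = Num nat | Cell nat aexp | Plus aexp aexp | Minus aexp aexp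

datatype bexp = Less aexp aexp | Eq aexp aexp

datatype com =
    Skip
  | Assign nat aexp aexp
  | Seq com com
  | Cond bexp com com
  | While bexp com

fun aval :: "aexp \<Rightarrow> state \<Rightarrow> nat" where
  "aval (Num n) s = n"
| "aval (Cell a i) s = s a (aval i s)"
| "aval (Plus x y) s = aval x s + aval y s"
| "aval (Minus x y) s = aval x s - aval y s"

fun bval :: "bexp \<Rightarrow> state \<Rightarrow> bool" where
  "bval (Less x y) s \<longleftrightarrow> aval x s < aval y s"
| "bval (Eq x y) s \<longleftrightarrow> aval x s = aval y s"

text \<open>\<open>exec p s k t\<close>: started in \<open>s\<close>, the program \<open>p\<close> halts in \<open>t\<close> after exactly \<open>k\<close> steps.\<close>

inductive exec :: "com \<Rightarrow> state \<Rightarrow> nat \<Rightarrow> state \<Rightarrow> bool" where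
  Skip: "exec Skip s 1 s"
| Assign: "exec (Assign a i x) s 1 (s(a := (s a)(aval i s := aval x s)))"
| Seq: "exec p s k t \<Longrightarrow> exec q t m u \<Longrightarrow> exec (Seq p q) s (k + m) u"
| CondTrue: "bval b s \<Longrightarrow> exec p s k t \<Longrightarrow> exec (Cond b p q) s (1 + k) t"
| CondFalse: "\<not> bval b s \<Longrightarrow> exec q s k t \<Longrightarrow> exec (Cond b p q) s (1 + k) t"
| WhileFalse: "\<not> bval b s \<Longrightarrow> exec (While b p) s 1 s"
| WhileTrue: "bval b s \<Longrightarrow> exec p s k t \<Longrightarrow> exec (While b p) t m u \<Longrightarrow>
    exec (While b p) s (1 + k + m) u"

lemma exec_deterministic:
  "exec p s k t \<Longrightarrow> exec p s k' t' \<Longrightarrow> k' = k \<and> t' = t"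
proof (induction arbitrary: k' t' rule: exec.induct)
  case (Skip s)
  from Skip.prems show ?case by cases simp_all
next
  case (Assign a i x s)
  from Assign.prems show ?case by cases simp_all
next
  case (Seq p s k t q m u)
  from Seq.prems show ?case by cases (use Seq.IH in blast)
next
  case (CondTrue b s p k t q)
  from CondTrue.prems show ?case by cases (use CondTrue.IH CondTrue.hyps in blast)+
next
  case (CondFalse b s q k t p)
  from CondFalse.prems show ?case by cases (use CondFalse.IH CondFalse.hyps in blast)+
next
  case (WhileFalse b s p)
  from WhileFalse.prems show ?case by cases (use WhileFalse.hyps in blast)+
next
  case (WhileTrue b s p k t m u)
  from WhileTrue.prems show ?case by cases (use WhileTrue.IH WhileTrue.hyps in blast)+
qed


section \<open>The problem LISTCOL on the machine\<close>

text \<open>Input format, for a graph with vertices \<open>0, \<dots>, n - 1\<close> and lists of \<open>l\<close> colours.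
  Array 0 holds \<open>n\<close> and \<open>l\<close>.  Arrays 1 and 2 hold the adjacency lists, in any order: the
  neighbours of \<open>v\<close> are the entries of array 2 at the positions from \<open>s 1 v\<close> up to, but not
  including, \<open>s 1 (v + 1)\<close>.  Array 3 holds the colour lists, in any order, that of \<open>v\<close> at the
  \<open>l\<close> positions from \<open>v * l\<close> on.  All other arrays are initially zero.\<close>

definition encodes :: "nat ugraph \<Rightarrow> nat \<Rightarrow> (nat \<Rightarrow> nat set) \<Rightarrow> state \<Rightarrow> bool" where
  "encodes G l L s \<longleftrightarrow>
     verts G = {..<s 0 0} \<and> s 0 1 = l \<and>
     s 1 0 = 0 \<and>
     (\<forall>v\<in>verts G. s 1 v \<le> s 1 (v + 1) \<and>
        bij_betw (s 2) {s 1 v..<s 1 (v + 1)} {w. {v, w} \<in> edges G}) \<and>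
     (\<forall>v\<in>verts G. bij_betw (\<lambda>i. s 3 (v * l + i)) {..<l} (L v)) \<and>
     (\<forall>a\<ge>4. \<forall>i. s a i = 0)"

text \<open>Output format: cell 0 of array 4 holds the answer (1 for yes, 0 for no), and if the answer is
  yes, array 5 holds a list colouring.  The colouring is part of the output because on graphs
  that are known to be choosable the bare decision would be constant.

  \<open>solves_LISTCOL p f T\<close>: the program \<open>p\<close> solves \<open>f(G)\<close>-LISTCOL on all instances
  \<open>(G, L)\<close>, where all lists have size \<open>f(G)\<close>, in at most \<open>T(G)\<close> steps.  The time may be less
  than the length of the input, since \<open>p\<close> need not read all the lists.\<close>

definition solves_LISTCOL ::
  "com \<Rightarrow> (nat ugraph \<Rightarrow> nat) \<Rightarrow> (nat ugraph \<Rightarrow> nat) \<Rightarrow> bool" where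
  "solves_LISTCOL p f T \<longleftrightarrow>
     (\<forall>G L s. finite_simple_graph G \<and> list_assignment G (f G) L \<and> encodes G (f G) L s \<longrightarrow>
        (\<exists>k t. exec p s k t \<and> k \<le> T G \<and>
           t 4 0 = (if \<exists>c. list_coloring G L c then 1 else 0) \<and>
           ((\<exists>c. list_coloring G L c) \<longrightarrow> list_coloring G L (t 5))))"

end

theory Submission
  imports Defs
begin

text \<open>Colour the vertices greedily in an order all of whose prefixes are connected within each
  component of \<open>G\<close>.  When \<open>v\<close> is coloured, any two coloured neighbours of \<open>v\<close> are joined by a
  path of coloured vertices and so lie on a cycle through \<open>v\<close>; hence all edges from \<open>v\<close> to
  coloured vertices belong to a single block, and a list of \<open>D + 1\<close> colours contains a free one.
  To exhibit the block, take a minimal connected set \<open>C\<close> of coloured vertices that contains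
  all coloured neighbours of \<open>v\<close>: the graph induced by \<open>C\<close> and \<open>v\<close> has no cut vertex.  A
  breadth-first search yields such an order without computing the blocks.  Finding
  the first free colour of \<open>v\<close> inspects at most \<open>deg v + 1\<close> entries of its list, so the time is
  linear although the lists may be longer than the graph.\<close>

section \<open>Blocks and the neighbours of a vertex in a connected set\<close>

definition induced :: "'a ugraph \<Rightarrow> 'a set \<Rightarrow> 'a ugraph" where
  "induced G S = \<lparr>verts = verts G \<inter> S, edges = {e \<in> edges G. e \<subseteq> S}\<rparr>"

lemma verts_induced [simp]: "verts (induced G S) = verts G \<inter> S"
  and edges_induced [simp]: "edges (induced G S) = {e \<in> edges G. e \<subseteq> S}"
  by (simp_all add: induced_def)

lemma remove_vertex_induced: "remove_vertex (induced G S) v = induced G (S - {v})"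
  by (auto simp: remove_vertex_def induced_def)

section \<open>Reachability as an equivalence relation, monotone in the edges\<close>

lemma reachable_refl [simp, intro]: "reachable G u u"
  by (simp add: reachable_def)

lemma reachable_edge: "{u, v} \<in> edges G \<Longrightarrow> reachable G u v"
  by (auto simp: reachable_def)

lemma reachable_trans: "reachable G u v \<Longrightarrow> reachable G v w \<Longrightarrow> reachable G u w"
  by (auto simp: reachable_def)

lemma reachable_step: "reachable G u v \<Longrightarrow> {v, w} \<in> edges G \<Longrightarrow> reachable G u w"
  by (blast intro: reachable_trans reachable_edge)

lemma reachable_sym: "reachable G u v \<Longrightarrow> reachable G v u"
proof -
  have "sym {(x, y). {x, y} \<in> edges G}"
    by (auto simp: sym_def insert_commute)
  then show "reachable G u v \<Longrightarrow> reachable G v u"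
    unfolding reachable_def by (meson sym_rtrancl symD)
qed

lemma reachable_mono: "reachable G u v \<Longrightarrow> edges G \<subseteq> edges H \<Longrightarrow> reachable H u v"
  unfolding reachable_def by (erule rtrancl_mono[THEN subsetD, rotated]) auto

lemma reachable_induced_mono: "reachable (induced G S) u v \<Longrightarrow> S \<subseteq> T \<Longrightarrow> reachable (induced G T) u v"
  by (erule reachable_mono) auto

lemma reachable_induct [consumes 1, case_names refl step]:
  assumes "reachable G u v" "P u"
    and "\<And>y z. reachable G u y \<Longrightarrow> {y, z} \<in> edges G \<Longrightarrow> P y \<Longrightarrow> P z"
  shows "P v"
  using assms unfolding reachable_def by (induction rule: rtrancl_induct) auto

section \<open>Finiteness, neighbours and degrees\<close>

lemma finite_edges: "finite_simple_graph G \<Longrightarrow> finite (edges G)"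
  by (rule finite_subset[of _ "Pow (verts G)"]) (auto simp: finite_simple_graph_def)

lemma edge_verts:
  assumes "finite_simple_graph G" "{u, v} \<in> edges G"
  shows "u \<in> verts G" "v \<in> verts G" "u \<noteq> v"
  using assms by (auto simp: finite_simple_graph_def)

lemma finite_simple_induced: "finite_simple_graph G \<Longrightarrow> finite_simple_graph (induced G S)"
  by (auto simp: finite_simple_graph_def)

lemma subgraph_induced: "finite_simple_graph G \<Longrightarrow> subgraph (induced G S) G"
  by (auto simp: subgraph_def finite_simple_induced)

lemma neighbours_degree:
  assumes "finite_simple_graph G"
  shows "bij_betw (\<lambda>w. {v, w}) {w. {v, w} \<in> edges G} {e \<in> edges G. v \<in> e}"
proof (rule bij_betwI')
  fix e assume "e \<in> {e \<in> edges G. v \<in> e}"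
  moreover then have "card e = 2" using assms by (auto simp: finite_simple_graph_def)
  ultimately show "\<exists>w\<in>{w. {v, w} \<in> edges G}. e = {v, w}"
    by (auto simp: card_2_iff insert_commute)
qed (auto simp: doubleton_eq_iff)

lemma finite_neighbours: "finite_simple_graph G \<Longrightarrow> finite {w. {v, w} \<in> edges G}"
  using neighbours_degree[of G v] finite_edges[of G] by (auto dest!: bij_betw_finite)

lemma card_neighbours: "finite_simple_graph G \<Longrightarrow> card {w. {v, w} \<in> edges G} = degree G v"
  unfolding degree_def by (rule bij_betw_same_card[OF neighbours_degree])

text \<open>Double counting of incidences. It turns running times charged per neighbour into a bound
  linear in the number of edges.\<close>

lemma sum_degree:
  assumes "finite_simple_graph G"
  shows "(\<Sum>v\<in>verts G. degree G v) = 2 * card (edges G)"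
proof -
  have fin: "finite (verts G)" using assms by (simp add: finite_simple_graph_def)
  have "(\<Sum>v\<in>verts G. degree G v) = (\<Sum>v\<in>verts G. \<Sum>e\<in>edges G. if v \<in> e then 1 else 0)"
    using finite_edges[OF assms] by (simp add: degree_def sum.If_cases Int_def)
  also have "\<dots> = (\<Sum>e\<in>edges G. \<Sum>v\<in>verts G. if v \<in> e then 1 else 0)"
    by (rule sum.swap)
  also have "\<dots> = (\<Sum>e\<in>edges G. 2)"
  proof (rule sum.cong[OF refl])
    fix e assume "e \<in> edges G"
    then have "verts G \<inter> e = e" "card e = 2" using assms by (auto simp: finite_simple_graph_def)
    then show "(\<Sum>v\<in>verts G. if v \<in> e then 1 else 0) = (2::nat)"
      using fin by (simp add: sum.If_cases Int_def)
  qed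
  finally show ?thesis by simp
qed

section \<open>Existence of blocks and their degrees\<close>

lemma subgraph_card:
  assumes "subgraph H G" "finite_simple_graph G"
  shows "card (verts H) \<le> card (verts G)" "card (edges H) \<le> card (edges G)"
  using assms finite_edges[OF assms(2)]
  by (auto simp: subgraph_def finite_simple_graph_def intro: card_mono)

text \<open>Among the admissible supergraphs of \<open>H\<close>, one with the most vertices plus
  edges is maximal under \<open>subgraph\<close>: a larger graph with no larger count has the same
  vertices and edges.\<close>

lemma ex_block_supergraph:
  assumes G: "finite_simple_graph G" and H: "subgraph H G" "connected_without_cut_vertex H"
  obtains B where "block G B" "subgraph H B"
proof -
  define P where "P B \<longleftrightarrow> subgraph B G \<and> connected_without_cut_vertex B \<and> subgraph H B" for B
  define f where "f B = card (verts B) + card (edges B)" for B :: "'a ugraph"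
  have "P H" using H by (auto simp: P_def subgraph_def)
  moreover have "\<forall>B. P B \<longrightarrow> f B < f G + 1"
    using subgraph_card[OF _ G] by (auto simp: P_def f_def less_Suc_eq_le intro: add_mono)
  ultimately obtain B where B: "P B" and max: "\<And>B'. P B' \<Longrightarrow> f B' \<le> f B"
    using ex_has_greatest_nat[of P H f] by blast
  have "B' = B" if B': "subgraph B' G" "connected_without_cut_vertex B'" "subgraph B B'" for B'
  proof -
    have "P B'" using B B' by (auto simp: P_def subgraph_def)
    then have le: "f B' \<le> f B" by (rule max)
    have fin: "finite_simple_graph B'" using B' by (simp add: subgraph_def)
    note c = subgraph_card[OF B'(3) fin]
    have "verts B = verts B'"
      using le c B'(3) fin by (intro card_subset_eq) (auto simp: f_def subgraph_def finite_simple_graph_def)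
    moreover have "edges B = edges B'"
      using le c B'(3) finite_edges[OF fin] by (intro card_subset_eq) (auto simp: f_def subgraph_def)
    ultimately show ?thesis by simp
  qed
  then have "block G B" using B by (auto simp: block_def P_def)
  then show thesis using B that by (auto simp: P_def)
qed

text \<open>\<open>Sup\<close> bounds only sets that are bounded above, so the maximum degrees of
  all blocks are first bounded by the number of edges of \<open>G\<close>.\<close>

lemma degree_le_max_block_degree:
  assumes G: "finite_simple_graph G" and B: "block G B" and v: "v \<in> verts B"
  shows "degree B v \<le> max_block_degree G"
proof -
  have fin: "finite (verts H)" "verts H \<noteq> {}" if "block G H" for H
    using that by (auto simp: block_def subgraph_def finite_simple_graph_def
        connected_without_cut_vertex_def connected_graph_def)
  have "max_degree H \<le> card (edges G)" if H: "block G H" for H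
  proof -
    have "degree H w \<le> card (edges G)" for w
    proof -
      have "edges H \<subseteq> edges G" using H by (simp add: block_def subgraph_def)
      then show ?thesis unfolding degree_def by (intro card_mono finite_edges G) auto
    qed
    then show ?thesis using fin[OF H] by (simp add: max_degree_def)
  qed
  then have "bdd_above {max_degree H |H. block G H}" by (auto intro!: bdd_aboveI)
  then have "max_degree B \<le> max_block_degree G"
    unfolding max_block_degree_def using B by (intro cSup_upper) auto
  moreover have "degree B v \<le> max_degree B"
    unfolding max_degree_def using fin[OF B] v by (intro Max_ge) auto
  ultimately show ?thesis by simp
qed

text \<open>Removing \<open>v\<close> leaves \<open>C\<close>, which is connected. If removing some
  \<open>x\<close> in \<open>C\<close> separated \<open>y\<close> from \<open>v\<close>, the part
  \<open>K\<close> left around \<open>y\<close> would contain no neighbour of \<open>v\<close>,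
  while \<open>C - K\<close> would still be connected, against minimality.\<close>

lemma connected_without_cut_vertex_add_vertex:
  assumes G: "finite_simple_graph G" and v: "v \<in> verts G" "v \<notin> C" and C: "C \<subseteq> verts G"
    and N: "a \<in> C" "{v, a} \<in> edges G"
    and conn: "\<And>x. x \<in> C \<Longrightarrow> reachable (induced G C) a x"
    and minimal: "\<And>C'. {w \<in> C. {v, w} \<in> edges G} \<subseteq> C' \<Longrightarrow> C' \<subset> C \<Longrightarrow> \<exists>x\<in>C'. \<not> reachable (induced G C') a x"
  shows "connected_without_cut_vertex (induced G (insert v C))"
proof -
  let ?H = "induced G (insert v C)"
  have vH: "verts ?H = insert v C" using v C by auto
  have "reachable ?H v x" if x: "x \<in> insert v C" for x
  proof (cases "x = v")
    case False
    then have "reachable ?H a x"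
      using x conn reachable_induced_mono[of G C a x "insert v C"] by auto
    moreover have "reachable ?H v a" using N by (intro reachable_edge) auto
    ultimately show ?thesis by (rule reachable_trans[rotated])
  qed auto
  then have 1: "connected_graph ?H"
    unfolding connected_graph_def vH by (blast intro: reachable_trans reachable_sym)
  have reach: "reachable (induced G (insert v C - {x})) y v" if x: "x \<in> C" and y: "y \<in> C" "y \<noteq> x" for x y
  proof (rule ccontr)
    assume not: "\<not> ?thesis"
    define K where "K = {z. reachable (induced G (insert v C - {x})) y z}"
    have K: "z \<in> C - {x} \<and> \<not> {v, z} \<in> edges G" if "z \<in> K" for z
    proof -
      have r: "reachable (induced G (insert v C - {x})) y z" using that by (simp add: K_def)
      then have "z \<in> insert v C - {x}"
        by (induction rule: reachable_induct) (use y in auto)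
      moreover have "z \<noteq> v" using r not by auto
      moreover have "\<not> {v, z} \<in> edges G"
      proof
        assume "{v, z} \<in> edges G"
        then have "{z, v} \<in> edges (induced G (insert v C - {x}))"
          using calculation x v by (auto simp: insert_commute)
        then show False using r not reachable_step by metis
      qed
      ultimately show ?thesis by auto
    qed
    text \<open>\<open>K\<close> is a component of \<open>C - {x}\<close> that is not adjacent to \<open>v\<close>, so it can be cut off.\<close>
    have to_x: "reachable (induced G (C - K)) z x" if z: "z \<in> C - K" for z
    proof -
      have xK: "x \<in> C - K" using x K by auto
      have "reachable (induced G C) x z"
        using conn[OF x] conn[of z] z by (auto intro: reachable_trans reachable_sym)
      then have "z \<notin> K \<longrightarrow> reachable (induced G (C - K)) x z"
      proof (induction rule: reachable_induct)
        case (step p q)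
        show ?case
        proof
          assume q: "q \<notin> K"
          have pq: "{p, q} \<in> edges G" "p \<in> C" "q \<in> C" using step by auto
          show "reachable (induced G (C - K)) x q"
          proof (cases "q = x")
            case False
            have "p \<notin> K"
            proof
              assume p: "p \<in> K"
              then have "{p, q} \<in> edges (induced G (insert v C - {x}))"
                using K[OF p] pq False by auto
              then have "q \<in> K" using p unfolding K_def by (auto intro: reachable_step)
              then show False using q by simp
            qed
            moreover have "{p, q} \<in> edges (induced G (C - K))" using pq q \<open>p \<notin> K\<close> by auto
            ultimately show ?thesis using step reachable_step by metis
          qed auto
        qed
      qed auto
      then show ?thesis using z reachable_sym by auto
    qed
    have "a \<notin> K" using K N by auto
    moreover have "{w \<in> C. {v, w} \<in> edges G} \<subseteq> C - K"
      using K by blast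
    moreover have "C - K \<subset> C" using y K_def by auto
    ultimately obtain z where "z \<in> C - K" "\<not> reachable (induced G (C - K)) a z"
      using minimal by blast
    then show False using to_x[of z] to_x[of a] N \<open>a \<notin> K\<close>
      by (auto intro: reachable_trans reachable_sym)
  qed
  have "\<not> cut_vertex ?H x" for x
  proof
    assume "cut_vertex ?H x"
    then obtain y z where x: "x \<in> insert v C" and yz: "y \<in> insert v C - {x}" "z \<in> insert v C - {x}"
      and not: "\<not> reachable (induced G (insert v C - {x})) y z"
      unfolding cut_vertex_def vH remove_vertex_induced by auto
    show False
    proof (cases "x = v")
      case True
      then have "reachable (induced G C) y z"
        using yz conn by (auto intro: reachable_trans reachable_sym)
      moreover have "insert v C - {x} = C" using True v by auto
      ultimately show False using not by simp
    next
      case False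
      then have "reachable (induced G (insert v C - {x})) w v" if "w \<in> insert v C - {x}" for w
        using reach[of x w] x that by auto
      then show False using not yz by (blast intro: reachable_trans reachable_sym)
    qed
  qed
  then show ?thesis using 1 by (simp add: connected_without_cut_vertex_def)
qed

section \<open>Greedy colouring\<close>

definition component_connected :: "'a ugraph \<Rightarrow> 'a set \<Rightarrow> bool" where
  "component_connected G S \<longleftrightarrow> S \<subseteq> verts G \<and>
     (\<forall>a\<in>S. \<forall>b\<in>S. reachable G a b \<longrightarrow> reachable (induced G S) a b)"

lemma component_connected_empty [simp]: "component_connected G {}"
  by (simp add: component_connected_def)

text \<open>In the first alternative \<open>v\<close> is joined to \<open>S\<close> through its
  neighbour \<open>u\<close>. In the second \<open>S\<close> is closed under adjacency, so
  \<open>v\<close> lies in a component that \<open>S\<close> does not meet, and nothing has to be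
  joined.\<close>

lemma component_connected_insert:
  assumes S: "component_connected G S" and v: "v \<in> verts G" "v \<notin> S"
    and adj: "(\<exists>u\<in>S. {u, v} \<in> edges G) \<or> (\<forall>u\<in>S. \<forall>w. {u, w} \<in> edges G \<longrightarrow> w \<in> S)"
  shows "component_connected G (insert v S)"
proof -
  let ?H = "induced G (insert v S)"
  have SS: "reachable ?H a b" if "a \<in> S" "b \<in> S" "reachable G a b" for a b
    using S that by (auto simp: component_connected_def intro: reachable_induced_mono)
  have Sv: "reachable ?H a v" if a: "a \<in> S" and r: "reachable G a v" for a
    using adj
  proof
    assume "\<exists>u\<in>S. {u, v} \<in> edges G"
    then obtain u where u: "u \<in> S" "{u, v} \<in> edges G" by blast
    then have "reachable G a u" using r by (meson reachable_edge reachable_sym reachable_trans)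
    then have "reachable ?H a u" using SS a u by blast
    then show ?thesis by (rule reachable_step) (use u in auto)
  next
    assume cl: "\<forall>u\<in>S. \<forall>w. {u, w} \<in> edges G \<longrightarrow> w \<in> S"
    from r have "v \<in> S" by (induction rule: reachable_induct) (use a cl in auto)
    then show ?thesis using v by simp
  qed
  have "reachable ?H v b" if "b \<in> S" "reachable G v b" for b
    using Sv that reachable_sym by metis
  then show ?thesis
    unfolding component_connected_def using S v SS Sv
    by (auto simp: component_connected_def)
qed

lemma card_neighbours_le_max_block_degree:
  assumes G: "finite_simple_graph G" and S: "component_connected G S" and v: "v \<in> verts G" "v \<notin> S"
  shows "card {w \<in> S. {v, w} \<in> edges G} \<le> max_block_degree G"
proof (cases "{w \<in> S. {v, w} \<in> edges G} = {}")
  case False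
  define N where "N = {w \<in> S. {v, w} \<in> edges G}"
  from False obtain a where a: "a \<in> N" by (auto simp: N_def)
  have finS: "finite S" using G S
    by (auto simp: finite_simple_graph_def component_connected_def intro: finite_subset)
  define P where "P C \<longleftrightarrow> N \<subseteq> C \<and> C \<subseteq> S \<and> (\<forall>x\<in>C. reachable (induced G C) a x)" for C
  \<comment> \<open>The component of \<open>a\<close> in the graph induced by \<open>S\<close> shows
    that \<open>P\<close> can be satisfied; a set of least cardinality is then minimal under
    inclusion.\<close>
  define C0 where "C0 = {x. reachable (induced G S) a x}"
  have "C0 \<subseteq> S"
  proof
    fix x assume "x \<in> C0"
    then have "reachable (induced G S) a x" by (simp add: C0_def)
    then show "x \<in> S" by (induction rule: reachable_induct) (use a in \<open>auto simp: N_def\<close>)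
  qed
  moreover have "N \<subseteq> C0"
  proof
    fix w assume w: "w \<in> N"
    \<comment> \<open>Two neighbours of \<open>v\<close> are joined in \<open>G\<close> through
      \<open>v\<close> itself; \<open>component_connected\<close> then provides a path inside
      \<open>S\<close>.\<close>
    then have "reachable G a w"
      using a by (auto simp: N_def intro: reachable_trans reachable_sym dest!: reachable_edge)
    then show "w \<in> C0" using S a w by (auto simp: component_connected_def C0_def N_def)
  qed
  moreover have "reachable (induced G C0) a x" if "x \<in> C0" for x
  proof -
    from that have "reachable (induced G S) a x" by (simp add: C0_def)
    then show ?thesis
    proof (induction rule: reachable_induct)
      case (step y z)
      have "reachable (induced G S) a z" using step reachable_step by metis
      then have "{y, z} \<in> edges (induced G C0)" using step by (auto simp: C0_def)
      then show ?case using step reachable_step by metis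
    qed auto
  qed
  ultimately have "P C0" by (auto simp: P_def)
  then obtain C where C: "P C" and min: "\<And>C'. P C' \<Longrightarrow> card C \<le> card C'"
    using ex_has_least_nat[of P C0 card] by blast
  have finC: "finite C" using C finS by (auto simp: P_def intro: finite_subset)
  have SV: "S \<subseteq> verts G" using S by (simp add: component_connected_def)
  let ?H = "induced G (insert v C)"
  have "connected_without_cut_vertex ?H"
  proof (rule connected_without_cut_vertex_add_vertex[where a = a])
    fix C' assume "{w \<in> C. {v, w} \<in> edges G} \<subseteq> C'" and C': "C' \<subset> C"
    then have "N \<subseteq> C'" using C by (auto simp: P_def N_def)
    then have "\<not> P C'" using min[of C'] psubset_card_mono[OF finC C'] by auto
    then show "\<exists>x\<in>C'. \<not> reachable (induced G C') a x" using C' C \<open>N \<subseteq> C'\<close> by (auto simp: P_def)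
  qed (use G v C a SV in \<open>auto simp: P_def N_def\<close>)
  then obtain B where B: "block G B" "subgraph ?H B"
    using ex_block_supergraph[OF G subgraph_induced[OF G]] by blast
  have finB: "finite_simple_graph B" using B(1) by (simp add: block_def subgraph_def)
  have "v \<in> verts B" using B(2) v by (auto simp: subgraph_def)
  have "card N \<le> card {w. {v, w} \<in> edges B}"
    using B(2) C by (intro card_mono finite_neighbours finB) (auto simp: subgraph_def P_def N_def)
  also have "\<dots> = degree B v" by (rule card_neighbours[OF finB])
  also have "\<dots> \<le> max_block_degree G"
    by (rule degree_le_max_block_degree) fact+
  finally show ?thesis by (simp add: N_def)
qed (simp only: card.empty)

text \<open>The coloured neighbours use fewer colours than \<open>A\<close> offers. As
  \<open>c\<close> is arbitrary, this serves both the existence proof and the colour array of the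
  program.\<close>

lemma ex_free_colour:
  assumes G: "finite_simple_graph G" and S: "component_connected G S" and v: "v \<in> verts G" "v \<notin> S"
    and A: "finite A" "card A = max_block_degree G + 1"
  obtains x where "x \<in> A" "\<And>w. w \<in> S \<Longrightarrow> {v, w} \<in> edges G \<Longrightarrow> c w \<noteq> x"
proof -
  let ?N = "{w \<in> S. {v, w} \<in> edges G}"
  have "finite ?N" by (rule finite_subset[OF _ finite_neighbours[OF G, of v]]) auto
  then have "card (c ` ?N) < card A" "finite (c ` ?N)"
    using card_neighbours_le_max_block_degree[OF G S v] card_image_le[of ?N c] A by auto
  then have "\<not> A \<subseteq> c ` ?N" using card_mono leD by blast
  then show thesis using that by blast
qed

text \<open>Induction on the number of coloured vertices: the next vertex is the end of an edge
  leaving \<open>S\<close> if there is one, and any remaining vertex otherwise. The vertices may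
  have any type here, so the program, which works on naturals, is not invoked.\<close>

lemma choosable_max_block_degree:
  assumes G: "finite_simple_graph G"
  shows "choosable G (max_block_degree G + 1)"
  unfolding choosable_def
proof (intro allI impI)
  fix L assume L: "list_assignment G (max_block_degree G + 1) L"
  have fin: "finite (verts G)" using G by (simp add: finite_simple_graph_def)
  have "\<exists>S c. component_connected G S \<and> card S = k \<and> list_coloring (induced G S) L c"
    if "k \<le> card (verts G)" for k
    using that
  proof (induction k)
    case 0
    show ?case
      using edge_verts[OF G] by (intro exI[of _ "{}"]) (auto simp: list_coloring_def)
  next
    case (Suc k)
    then obtain S c where S: "component_connected G S" "card S = k"
      and c: "list_coloring (induced G S) L c" by auto
    have SV: "S \<subseteq> verts G" using S by (simp add: component_connected_def)
    have "\<exists>v\<in>verts G - S. (\<exists>u\<in>S. {u, v} \<in> edges G) \<or> (\<forall>u\<in>S. \<forall>w. {u, w} \<in> edges G \<longrightarrow> w \<in> S)"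
    proof (cases "\<forall>u\<in>S. \<forall>w. {u, w} \<in> edges G \<longrightarrow> w \<in> S")
      case True
      moreover have "S \<noteq> verts G" using Suc.prems S by auto
      ultimately show ?thesis using SV by blast
    next
      case False
      then show ?thesis using edge_verts[OF G] by blast
    qed
    then obtain v where v: "v \<in> verts G" "v \<notin> S"
      and adj: "(\<exists>u\<in>S. {u, v} \<in> edges G) \<or> (\<forall>u\<in>S. \<forall>w. {u, w} \<in> edges G \<longrightarrow> w \<in> S)" by blast
    have "finite (L v)" "card (L v) = max_block_degree G + 1"
      using L v by (auto simp: list_assignment_def)
    from ex_free_colour[OF G S(1) v this, where c = c]
    obtain x where x: "x \<in> L v" "\<And>w. w \<in> S \<Longrightarrow> {v, w} \<in> edges G \<Longrightarrow> c w \<noteq> x" by blast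
    \<comment> \<open>\<open>list_coloring\<close> also quantifies over equal endpoints, where the
      edge would be a singleton.\<close>
    have "{v} \<notin> edges G" using edge_verts(3)[OF G, of v v] by auto
    then have "list_coloring (induced G (insert v S)) L (c(v := x))"
      using c x v edge_verts[OF G]
      by (auto simp: list_coloring_def insert_commute) 
    moreover have "card (insert v S) = Suc k"
      using S v fin SV by (simp add: finite_subset)
    ultimately show ?case using component_connected_insert[OF S(1) v adj] by blast
  qed
  from this[of "card (verts G)"] obtain S c where S: "component_connected G S"
    "card S = card (verts G)" and c: "list_coloring (induced G S) L c" by auto
  then have "S = verts G" using fin by (intro card_subset_eq) (auto simp: component_connected_def)
  moreover have "induced G (verts G) = G"
    using G by (intro ugraph.equality) (auto simp: finite_simple_graph_def)
  ultimately show "\<exists>c. list_coloring G L c" using c by auto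
qed

section \<open>Running time of programs by potentials\<close>

text \<open>Total correctness: the existential includes termination, and the postcondition sees the
  exact number of steps.\<close>

definition wp :: "com \<Rightarrow> (nat \<Rightarrow> state \<Rightarrow> bool) \<Rightarrow> state \<Rightarrow> bool" where
  "wp p Q s \<longleftrightarrow> (\<exists>k t. exec p s k t \<and> Q k t)"

lemma wp_mono: "wp p Q s \<Longrightarrow> (\<And>k t. Q k t \<Longrightarrow> R k t) \<Longrightarrow> wp p R s"
  by (auto simp: wp_def)

text \<open>By determinism, a run obtained once can be inserted wherever its starting state turns
  up; this composes separately verified loops.\<close>

lemma wp_exec: "exec p s k t \<Longrightarrow> wp p Q s \<longleftrightarrow> Q k t"
  by (auto simp: wp_def dest: exec_deterministic)

lemma wp_Skip [simp]: "wp Skip Q s \<longleftrightarrow> Q 1 s"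
  by (auto simp: wp_def simp del: One_nat_def intro: exec.intros elim: exec.cases)

lemma wp_Assign [simp]:
  "wp (Assign a i x) Q s \<longleftrightarrow> Q 1 (s(a := (s a)(aval i s := aval x s)))"
  by (auto simp: wp_def simp del: One_nat_def intro: exec.intros elim: exec.cases)

lemma wp_Seq [simp]: "wp (Seq p q) Q s \<longleftrightarrow> wp p (\<lambda>k. wp q (\<lambda>m. Q (k + m))) s"
proof
  assume "wp (Seq p q) Q s"
  then obtain k t where "exec (Seq p q) s k t" "Q k t" by (auto simp: wp_def)
  then show "wp p (\<lambda>k. wp q (\<lambda>m. Q (k + m))) s"
    by cases (auto simp: wp_def)
qed (auto simp: wp_def intro: exec.Seq)

lemma wp_Cond [simp]:
  "wp (Cond b p q) Q s \<longleftrightarrow> (if bval b s then wp p (\<lambda>k. Q (1 + k)) s else wp q (\<lambda>k. Q (1 + k)) s)"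
proof
  assume "wp (Cond b p q) Q s"
  then obtain k t where "exec (Cond b p q) s k t" "Q k t" by (auto simp: wp_def)
  then show "if bval b s then wp p (\<lambda>k. Q (1 + k)) s else wp q (\<lambda>k. Q (1 + k)) s"
    by cases (auto simp: wp_def)
next
  assume "if bval b s then wp p (\<lambda>k. Q (1 + k)) s else wp q (\<lambda>k. Q (1 + k)) s"
  then show "wp (Cond b p q) Q s"
    by (auto simp: wp_def simp del: One_nat_def plus_1_eq_Suc split: if_splits
        intro: exec.CondTrue exec.CondFalse)
qed

text \<open>The potential \<open>f\<close> pays for each iteration, including the evaluation of the test; the
  last test costs the additional step.\<close>

lemma wp_While:
  assumes I: "I s"
    and step: "\<And>s. I s \<Longrightarrow> bval b s \<Longrightarrow> wp p (\<lambda>k t. I t \<and> k + f t < f s) s"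
    and post: "\<And>k t. I t \<Longrightarrow> \<not> bval b t \<Longrightarrow> k + f t \<le> f s + 1 \<Longrightarrow> Q k t"
  shows "wp (While b p) Q s"
proof -
  have "\<exists>k t. exec (While b p) s k t \<and> I t \<and> \<not> bval b t \<and> k + f t \<le> f s + 1"
    using I
  proof (induction "f s" arbitrary: s rule: less_induct)
    case less
    show ?case
    proof (cases "bval b s")
      case True
      then obtain k t where kt: "exec p s k t" "I t" "k + f t < f s"
        using step[OF less.prems] by (auto simp: wp_def)
      then obtain m u where "exec (While b p) t m u" "I u" "\<not> bval b u" "m + f u \<le> f t + 1"
        using less.hyps[of t] by auto
      then show ?thesis
        using exec.WhileTrue[OF True kt(1)] kt by (intro exI[of _ "1 + k + m"] exI[of _ u]) auto
    next
      case False
      then show ?thesis using less.prems exec.WhileFalse by fastforce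
    qed
  qed
  then show ?thesis using post by (auto simp: wp_def)
qed

section \<open>Search orders\<close>

text \<open>The two alternatives are those of \<open>component_connected_insert\<close>, so every
  prefix is connected within each component.\<close>

definition search_order :: "'a ugraph \<Rightarrow> (nat \<Rightarrow> 'a) \<Rightarrow> nat \<Rightarrow> bool" where
  "search_order G Q m \<longleftrightarrow> (\<forall>i<m. Q i \<in> verts G \<and> Q i \<notin> Q ` {..<i} \<and>
     ((\<exists>u\<in>Q ` {..<i}. {u, Q i} \<in> edges G) \<or>
      (\<forall>u\<in>Q ` {..<i}. \<forall>w. {u, w} \<in> edges G \<longrightarrow> w \<in> Q ` {..<i})))"

lemma image_lessThan_upd: "i \<le> m \<Longrightarrow> (Q(m := w)) ` {..<i} = Q ` {..<i::nat}"
  by (auto simp: image_iff)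

lemma image_lessThan_Suc_upd: "(Q(m := w)) ` {..<Suc m} = insert w (Q ` {..<m::nat})"
  by (simp only: lessThan_Suc image_insert fun_upd_same image_lessThan_upd[OF order_refl])

lemma search_order_append:
  assumes "search_order G Q m" "w \<in> verts G" "w \<notin> Q ` {..<m}"
    and "(\<exists>u\<in>Q ` {..<m}. {u, w} \<in> edges G) \<or>
      (\<forall>u\<in>Q ` {..<m}. \<forall>w. {u, w} \<in> edges G \<longrightarrow> w \<in> Q ` {..<m})"
  shows "search_order G (Q(m := w)) (Suc m)"
  unfolding search_order_def
proof (intro allI impI)
  fix i assume "i < Suc m"
  then have i: "i \<le> m" by simp
  show "(Q(m := w)) i \<in> verts G \<and> (Q(m := w)) i \<notin> (Q(m := w)) ` {..<i} \<and>
     ((\<exists>u\<in>(Q(m := w)) ` {..<i}. {u, (Q(m := w)) i} \<in> edges G) \<or>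
      (\<forall>u\<in>(Q(m := w)) ` {..<i}. \<forall>x. {u, x} \<in> edges G \<longrightarrow> x \<in> (Q(m := w)) ` {..<i}))"
    unfolding image_lessThan_upd[OF i]
    using assms i by (cases "i = m") (simp_all add: search_order_def)
qed

lemma search_order_component_connected:
  "search_order G Q m \<Longrightarrow> i \<le> m \<Longrightarrow> component_connected G (Q ` {..<i})"
proof (induction i)
  case (Suc i)
  then have "component_connected G (insert (Q i) (Q ` {..<i}))"
    by (intro component_connected_insert) (auto simp: search_order_def)
  then show ?case by (simp add: lessThan_Suc)
qed simp

lemma search_order_inj: "search_order G Q m \<Longrightarrow> inj_on Q {..<m}"
  unfolding search_order_def inj_on_def
  by (metis imageI lessThan_iff linorder_neqE_nat)

section \<open>The program\<close>

text \<open>Memory of the program: the scalar variables are the cells of array 6.  Array 7 is the queue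
  of the search, which is never overwritten and therefore holds the search order at the end, and
  array 8 flags the vertices that have been enqueued.  Array 9 holds the offsets \<open>v * l\<close> of the
  colour lists, obtained by repeated addition because multiplication is not available.  Array 10
  holds the colour of a vertex plus 1, and 0 for an uncoloured vertex; it is indexed into array 11,
  where the stamp \<open>v + 1\<close> marks the colours used in the neighbourhood of \<open>v\<close>, so that
  the marks never have to be erased and uncoloured neighbours only mark the harmless index 0.\<close>

abbreviation var :: "nat \<Rightarrow> aexp" where
  "var x \<equiv> Cell 6 (Num x)"

abbreviation set_var :: "nat \<Rightarrow> aexp \<Rightarrow> com" where
  "set_var x \<equiv> Assign 6 (Num x)"

abbreviation incr :: "nat \<Rightarrow> com" where
  "incr x \<equiv> set_var x (Plus (var x) (Num 1))"

text \<open>Cell 0 of array 6 counts the vertices. The initial zero in cell 0 of array 9 is already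
  the offset of vertex 0.\<close>

definition offsets :: com where
  "offsets = While (Less (var 0) (Cell 0 (Num 0)))
     (Seq (Assign 9 (Plus (var 0) (Num 1)) (Plus (Cell 9 (var 0)) (Cell 0 (Num 1)))) (incr 0))"

text \<open>Scalars of the search: cell 1 is the next candidate for a root, cells 2 and 3 are head
  and tail of the queue, cells 4 and 5 hold the scanned vertex and the position in its adjacency
  list.\<close>

definition enqueue :: "aexp \<Rightarrow> com" where
  "enqueue x = Cond (Eq (Cell 8 x) (Num 0))
     (Seq (Assign 7 (var 3) x) (Seq (Assign 8 x (Num 1)) (incr 3))) Skip"

definition enqueue_neighbours :: com where
  "enqueue_neighbours = While (Less (var 5) (Cell 1 (Plus (var 4) (Num 1))))
     (Seq (enqueue (Cell 2 (var 5))) (incr 5))"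

text \<open>A root is tried only when the queue is exhausted, hence all enqueued vertices are
  scanned before a new component begins. The loop may stop with its last root unscanned, as every
  vertex is enqueued by then.\<close>

definition search :: com where
  "search = While (Less (var 1) (Cell 0 (Num 0)))
     (Cond (Less (var 2) (var 3))
       (Seq (set_var 4 (Cell 7 (var 2))) (Seq (set_var 5 (Cell 1 (var 4)))
         (Seq enqueue_neighbours (incr 2))))
       (Seq (enqueue (var 1)) (incr 1)))"

text \<open>Cell 7 is the vertex to be coloured, cell 8 the position in its adjacency list. Adding 1
  keeps the stamp of vertex 0 apart from the initial zeros.\<close>

definition mark_neighbours :: com where
  "mark_neighbours = While (Less (var 8) (Cell 1 (Plus (var 7) (Num 1))))
     (Seq (Assign 11 (Cell 10 (Cell 2 (var 8))) (Plus (var 7) (Num 1))) (incr 8))"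

text \<open>Cell 9 runs through the colour list without a bound check: a free colour stops it inside
  the list.\<close>

definition find_unmarked :: com where
  "find_unmarked = While (Eq (Cell 11 (Plus (Cell 3 (var 9)) (Num 1))) (Plus (var 7) (Num 1)))
     (incr 9)"

definition colour_vertex :: com where
  "colour_vertex = Seq (set_var 7 (Cell 7 (var 6))) (Seq (set_var 8 (Cell 1 (var 7)))
     (Seq mark_neighbours (Seq (set_var 9 (Cell 9 (var 7))) (Seq find_unmarked
     (Seq (Assign 10 (var 7) (Plus (Cell 3 (var 9)) (Num 1)))
     (Seq (Assign 5 (var 7) (Cell 3 (var 9))) (incr 6)))))))"

definition colour :: com where
  "colour = While (Less (var 6) (Cell 0 (Num 0))) colour_vertex"

definition greedy :: com where
  "greedy = Seq offsets (Seq search (Seq colour (Assign 4 (Num 0) (Num 1))))"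

section \<open>Correctness and running time of the program\<close>

text \<open>\<open>z\<close> is the initial memory, with which later states are compared.\<close>

locale listcol_input =
  fixes G :: "nat ugraph" and l :: nat and L :: "nat \<Rightarrow> nat set" and z :: state and n :: nat
  assumes G: "finite_simple_graph G"
    and L: "list_assignment G l L" "l = max_block_degree G + 1"
    and z: "encodes G l L z"
    and n: "n = z 0 0"
begin

definition input :: "state \<Rightarrow> bool" where
  "input s \<longleftrightarrow> s 0 = z 0 \<and> s 1 = z 1 \<and> s 2 = z 2 \<and> s 3 = z 3"

lemma V: "verts G = {..<n}" and l: "z 0 (Suc 0) = l" and z0: "a \<ge> 4 \<Longrightarrow> z a i = 0"
  and adj_mono: "v < n \<Longrightarrow> z 1 v \<le> z 1 (Suc v)"
  and adj_bij: "v < n \<Longrightarrow> bij_betw (z 2) {z 1 v..<z 1 (Suc v)} {w. {v, w} \<in> edges G}"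
  and list_bij: "v < n \<Longrightarrow> bij_betw (\<lambda>i. z 3 (v * l + i)) {..<l} (L v)"
  using z n by (auto simp: encodes_def)

lemma degree_eq: "v < n \<Longrightarrow> degree G v = z 1 (Suc v) - z 1 v"
  using bij_betw_same_card[OF adj_bij[of v]] card_neighbours[OF G, of v] by simp

lemma adj_iff: "v < n \<Longrightarrow> {v, w} \<in> edges G \<longleftrightarrow> (\<exists>j\<in>{z 1 v..<z 1 (Suc v)}. z 2 j = w)"
  using bij_betw_imp_surj_on[OF adj_bij[of v]] by (simp add: set_eq_iff image_iff) metis

lemma edge_less: "{u, w} \<in> edges G \<Longrightarrow> u < n \<and> w < n \<and> u \<noteq> w"
  using edge_verts[OF G, of u w] V by auto

lemma offsets_correct:
  "wp offsets (\<lambda>k t. k \<le> 3 * n + 1 \<and> (\<forall>v<n. t 9 v = v * l) \<and> (\<forall>x>0. t 6 x = 0) \<and>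
     (\<forall>a. a \<noteq> 6 \<and> a \<noteq> 9 \<longrightarrow> t a = z a)) z"
  unfolding offsets_def
  \<comment> \<open>Each vertex pays for the test and two assignments.\<close>
  by (rule wp_While[where f = "\<lambda>s. 3 * (n - s 6 0)" and
        I = "\<lambda>s. s 6 0 \<le> n \<and> (\<forall>v\<le>s 6 0. s 9 v = v * l) \<and> (\<forall>x>0. s 6 x = 0) \<and>
          (\<forall>a. a \<noteq> 6 \<and> a \<noteq> 9 \<longrightarrow> s a = z a)"])
    (auto simp: z0 l n[symmetric])

section \<open>Breadth-first search\<close>

definition queue :: "(nat \<Rightarrow> nat) \<Rightarrow> nat \<Rightarrow> (nat \<Rightarrow> nat) \<Rightarrow> bool" where
  "queue Q m vis \<longleftrightarrow> search_order G Q m \<and> (\<forall>w. vis w \<noteq> 0 \<longleftrightarrow> w \<in> Q ` {..<m})"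

lemma queue_append:
  assumes q: "queue Q m vis" "vis w = 0" "w < n"
    and "(\<exists>i<m. {Q i, w} \<in> edges G) \<or> (\<forall>i<m. \<forall>w. {Q i, w} \<in> edges G \<longrightarrow> w \<in> Q ` {..<m})"
  shows "queue (Q(m := w)) (Suc m) (vis(w := Suc 0))"
proof -
  have "search_order G (Q(m := w)) (Suc m)"
  proof (rule search_order_append)
    show "w \<notin> Q ` {..<m}" using assms(2) q unfolding queue_def by blast
  qed (use assms V in \<open>auto simp: queue_def\<close>)
  then show ?thesis
    unfolding queue_def image_lessThan_Suc_upd using assms by (simp add: queue_def)
qed

text \<open>For \<open>h = m\<close> the queue is closed under adjacency, which is the second
  alternative in \<open>search_order\<close>.\<close>

definition scanned :: "(nat \<Rightarrow> nat) \<Rightarrow> nat \<Rightarrow> nat \<Rightarrow> bool" where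
  "scanned Q h m \<longleftrightarrow> (\<forall>i<h. \<forall>w. {Q i, w} \<in> edges G \<longrightarrow> w \<in> Q ` {..<m})"

lemma scanned_append: "scanned Q h m \<Longrightarrow> h \<le> m \<Longrightarrow> scanned (Q(m := w)) h (Suc m)"
  unfolding scanned_def image_lessThan_Suc_upd by simp

lemma enqueue_neighbours_correct:
  assumes y: "input y" "queue (y 7) (y 6 3) (y 8)" "scanned (y 7) h (y 6 3)" "h < y 6 3"
    "y 7 h = v" "y 6 4 = v" "y 6 5 = z 1 v" and v: "v < n"
  shows "wp enqueue_neighbours (\<lambda>k t. k \<le> 7 * degree G v + 1 \<and>
     queue (t 7) (t 6 3) (t 8) \<and> scanned (t 7) (Suc h) (t 6 3) \<and> h < t 6 3 \<and>
     y 6 3 \<le> t 6 3 \<and> (\<forall>i<y 6 3. t 7 i = y 7 i) \<and>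
     (\<forall>x. x \<noteq> 3 \<and> x \<noteq> 5 \<longrightarrow> t 6 x = y 6 x) \<and>
     (\<forall>a. a \<noteq> 6 \<and> a \<noteq> 7 \<and> a \<noteq> 8 \<longrightarrow> t a = y a)) y"
  unfolding enqueue_neighbours_def enqueue_def
\<comment> \<open>An iteration takes at most six steps including its test; each entry of the
  adjacency list provides seven.\<close>
proof (rule wp_While[where f = "\<lambda>s. 7 * (z 1 (Suc v) - s 6 5)" and
    I = "\<lambda>s. queue (s 7) (s 6 3) (s 8) \<and> scanned (s 7) h (s 6 3) \<and> h < s 6 3 \<and>
      y 6 3 \<le> s 6 3 \<and> (\<forall>i<y 6 3. s 7 i = y 7 i) \<and>
      z 1 v \<le> s 6 5 \<and> (\<forall>j\<in>{z 1 v..<s 6 5}. z 2 j \<in> s 7 ` {..<s 6 3}) \<and>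
      (\<forall>x. x \<noteq> 3 \<and> x \<noteq> 5 \<longrightarrow> s 6 x = y 6 x) \<and>
      (\<forall>a. a \<noteq> 6 \<and> a \<noteq> 7 \<and> a \<noteq> 8 \<longrightarrow> s a = y a)"], goal_cases)
  case (2 s)
  have in_s: "s 1 = z 1" "s 2 = z 2" "s 6 4 = v" using 2 y by (auto simp: input_def)
  have j: "s 6 5 < z 1 (Suc v)" using 2 in_s by simp
  let ?w = "z 2 (s 6 5)"
  have e: "{v, ?w} \<in> edges G" using adj_iff[OF v] j 2 by auto
  have h: "s 7 h = v" using 2 y by auto
  \<comment> \<open>The witness is position \<open>h\<close>, where \<open>v\<close> stands in the
    queue.\<close>
  have e': "(\<exists>i<s 6 3. {s 7 i, ?w} \<in> edges G)" using e h 2 by auto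
  show ?case
  proof (cases "s 8 ?w = 0")
    case True
    then have "queue ((s 7)(s 6 3 := ?w)) (Suc (s 6 3)) ((s 8)(?w := Suc 0))"
      using 2 e e' edge_less by (intro queue_append) auto
    then show ?thesis
      using True 2 j in_s scanned_append[of "s 7" h "s 6 3"]
      by (auto simp: image_lessThan_Suc_upd less_Suc_eq cong del: image_cong_simp)
  next
    case False
    then have "?w \<in> s 7 ` {..<s 6 3}" using 2 by (auto simp: queue_def)
    then show ?thesis using False 2 j in_s by (auto simp: less_Suc_eq)
  qed
next
  case (3 k t)
  have in_t: "t 1 = z 1" "t 6 4 = v" using 3 y by (auto simp: input_def)
  have "w \<in> t 7 ` {..<t 6 3}" if "{v, w} \<in> edges G" for w
    using that 3 in_t adj_iff[OF v, of w] by force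
  moreover have "t 7 h = v" using 3 y by auto
  ultimately have "scanned (t 7) (Suc h) (t 6 3)"
    using 3 by (auto simp: scanned_def less_Suc_eq)
  then show ?case using 3 y degree_eq[OF v] by auto
qed (use y in auto)

text \<open>Every iteration either scans the head of the queue or uses up a root candidate, and each
  vertex undergoes both at most once. The potential therefore adds a charge for the remaining
  candidates to one for the unscanned vertices, enqueued or not.\<close>

lemma search_correct:
  assumes y: "input y" "\<forall>x>0. y 6 x = 0" "\<forall>i. y 7 i = 0" "\<forall>i. y 8 i = 0"
  shows "wp search (\<lambda>k t. k \<le> 14 * card (edges G) + 14 * n + 1 \<and>
     search_order G (t 7) n \<and> t 7 ` {..<n} = {..<n} \<and> t 6 6 = 0 \<and>
     (\<forall>a. a \<noteq> 6 \<and> a \<noteq> 7 \<and> a \<noteq> 8 \<longrightarrow> t a = y a)) y"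
  unfolding search_def
proof (rule wp_While[where
    f = "\<lambda>s. 7 * (n - s 6 1) + (\<Sum>v\<in>{..<n} - s 7 ` {..<s 6 2}. 7 * degree G v + 7)" and
    I = "\<lambda>s. queue (s 7) (s 6 3) (s 8) \<and> scanned (s 7) (s 6 2) (s 6 3) \<and> s 6 2 \<le> s 6 3 \<and>
      s 6 1 \<le> n \<and> {..<s 6 1} \<subseteq> s 7 ` {..<s 6 3} \<and> s 6 6 = 0 \<and>
      (\<forall>a. a \<noteq> 6 \<and> a \<noteq> 7 \<and> a \<noteq> 8 \<longrightarrow> s a = y a)"], goal_cases)
  case 1
  then show ?case using y by (auto simp: queue_def scanned_def search_order_def)
next
  case (2 s)
  have in_s: "s 0 = z 0" "s 1 = z 1" "input s" using 2 y by (auto simp: input_def)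
  show ?case
  proof (cases "s 6 2 < s 6 3")
    case True
    define v where "v = s 7 (s 6 2)"
    have ord: "search_order G (s 7) (s 6 3)" using 2 by (simp add: queue_def)
    have v: "v < n" "v \<notin> s 7 ` {..<s 6 2}"
      using ord True V by (auto simp: search_order_def v_def)
    define s' where "s' = s(6 := (s 6)(4 := v, 5 := z 1 v))"
    have *: "wp enqueue_neighbours (\<lambda>k t. k \<le> 7 * degree G v + 1 \<and>
     queue (t 7) (t 6 3) (t 8) \<and> scanned (t 7) (Suc (s 6 2)) (t 6 3) \<and> s 6 2 < t 6 3 \<and>
     s' 6 3 \<le> t 6 3 \<and> (\<forall>i<s' 6 3. t 7 i = s' 7 i) \<and>
     (\<forall>x. x \<noteq> 3 \<and> x \<noteq> 5 \<longrightarrow> t 6 x = s' 6 x) \<and>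
     (\<forall>a. a \<noteq> 6 \<and> a \<noteq> 7 \<and> a \<noteq> 8 \<longrightarrow> t a = s' a)) s'"
      by (rule enqueue_neighbours_correct)
        (use 2 in_s True v in \<open>auto simp: s'_def v_def input_def\<close>)
    \<comment> \<open>The three leading units are the test for a nonempty queue and the two
      assignments that lead from \<open>s\<close> to \<open>s'\<close>.\<close>
    have "wp enqueue_neighbours (\<lambda>k. wp (incr 2) (\<lambda>m t.
       (queue (t 7) (t 6 3) (t 8) \<and> scanned (t 7) (t 6 2) (t 6 3) \<and> t 6 2 \<le> t 6 3 \<and>
        t 6 1 \<le> n \<and> {..<t 6 1} \<subseteq> t 7 ` {..<t 6 3} \<and> t 6 6 = 0 \<and>
        (\<forall>a. a \<noteq> 6 \<and> a \<noteq> 7 \<and> a \<noteq> 8 \<longrightarrow> t a = y a)) \<and>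
       1 + (1 + (1 + (k + m))) + (7 * (n - t 6 1) + (\<Sum>v\<in>{..<n} - t 7 ` {..<t 6 2}. 7 * degree G v + 7)) <
       7 * (n - s 6 1) + (\<Sum>v\<in>{..<n} - s 7 ` {..<s 6 2}. 7 * degree G v + 7))) s'"
    proof (rule wp_mono[OF *], goal_cases)
      case (1 k t)
      then have eq: "\<And>i. i < s 6 3 \<Longrightarrow> t 7 i = s 7 i" "t 6 2 = s 6 2" "t 6 1 = s 6 1" "t 6 6 = s 6 6"
        and le: "s 6 3 \<le> t 6 3"
        by (auto simp: s'_def)
      have im: "t 7 ` {..<Suc (s 6 2)} = insert v (s 7 ` {..<s 6 2})"
        using eq True by (auto simp: v_def lessThan_Suc)
      have "{..<n} - s 7 ` {..<s 6 2} = insert v ({..<n} - insert v (s 7 ` {..<s 6 2}))"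
        using v by auto
      then have sum: "(\<Sum>v\<in>{..<n} - s 7 ` {..<s 6 2}. 7 * degree G v + 7) =
          7 * degree G v + 7 + (\<Sum>v\<in>{..<n} - insert v (s 7 ` {..<s 6 2}). 7 * degree G v + 7)"
        by (metis (no_types, lifting) Diff_iff finite_Diff finite_lessThan insertI1 sum.insert)
      have "s 7 ` {..<s 6 3} = t 7 ` {..<s 6 3}" using eq(1) by auto
      also have "\<dots> \<subseteq> t 7 ` {..<t 6 3}" using le by auto
      finally show ?case using 1 2 eq(2-) im sum by (auto simp: s'_def)
    qed
    then show ?thesis using True in_s by (simp add: s'_def v_def)
  next
    case False
    then have eq: "s 6 2 = s 6 3" using 2 by simp
    show ?thesis
    proof (cases "s 8 (s 6 1) = 0")
      case True
      \<comment> \<open>The queue is exhausted and so closed under adjacency: the new root starts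
        another component.\<close>
      have "queue ((s 7)(s 6 3 := s 6 1)) (Suc (s 6 3)) ((s 8)(s 6 1 := Suc 0))"
        using True 2 eq in_s n by (intro queue_append) (auto simp: scanned_def)
      then show ?thesis
        using True False eq 2 in_s n scanned_append[of "s 7" "s 6 3" "s 6 3"]
        by (auto simp: image_lessThan_Suc_upd image_lessThan_upd enqueue_def less_Suc_eq)
    next
      case False
      then have "s 6 1 \<in> s 7 ` {..<s 6 3}" using 2 by (auto simp: queue_def)
      then show ?thesis
        using False eq 2 in_s n by (auto simp: enqueue_def less_Suc_eq)
    qed
  qed
next
  case (3 k t)
  have Q: "{..<n} \<subseteq> t 7 ` {..<t 6 3}" and ord: "search_order G (t 7) (t 6 3)"
    using 3 y n by (auto simp: queue_def input_def)
  then have im: "t 7 ` {..<t 6 3} = {..<n}"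
    using V by (auto simp: search_order_def)
  \<comment> \<open>The entries of the queue are distinct and exhaust the \<open>n\<close> vertices,
    which fixes its length.\<close>
  then have m: "t 6 3 = n" using card_image[OF search_order_inj[OF ord]] by simp
  have "(\<Sum>v<n. 7 * degree G v + 7) = 14 * card (edges G) + 7 * n"
    using sum_degree[OF G] by (simp add: sum.distrib V flip: sum_distrib_left)
  then show ?case using 3 y im ord m by auto
qed

section \<open>Colouring in search order\<close>

lemma mark_neighbours_correct:
  assumes y: "input y" "y 6 7 = v" "y 6 8 = z 1 v" and v: "v < n"
  shows "wp mark_neighbours (\<lambda>k t. k \<le> 3 * degree G v + 1 \<and>
     (\<forall>c. t 11 c = (if \<exists>w. {v, w} \<in> edges G \<and> y 10 w = c then Suc v else y 11 c)) \<and>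
     (\<forall>x. x \<noteq> 8 \<longrightarrow> t 6 x = y 6 x) \<and> (\<forall>a. a \<noteq> 6 \<and> a \<noteq> 11 \<longrightarrow> t a = y a)) y"
  unfolding mark_neighbours_def
proof (rule wp_While[where f = "\<lambda>s. 3 * (z 1 (Suc v) - s 6 8)" and
    I = "\<lambda>s. z 1 v \<le> s 6 8 \<and> s 6 8 \<le> z 1 (Suc v) \<and>
      (\<forall>c. s 11 c = (if \<exists>j\<in>{z 1 v..<s 6 8}. y 10 (z 2 j) = c then Suc v else y 11 c)) \<and>
      (\<forall>x. x \<noteq> 8 \<longrightarrow> s 6 x = y 6 x) \<and> (\<forall>a. a \<noteq> 6 \<and> a \<noteq> 11 \<longrightarrow> s a = y a)"], goal_cases)
  case 1
  then show ?case using y adj_mono[OF v] by auto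
next
  case (2 s)
  have in_s: "s 1 = z 1" "s 2 = z 2" "s 6 7 = v" using 2 y by (auto simp: input_def)
  then show ?case using 2 by (auto simp: less_Suc_eq)
next
  case (3 k t)
  then have "t 6 8 = z 1 (Suc v)" using y by (auto simp: input_def)
  then have "(\<exists>j\<in>{z 1 v..<t 6 8}. y 10 (z 2 j) = c) \<longleftrightarrow> (\<exists>w. {v, w} \<in> edges G \<and> y 10 w = c)" for c
    by (auto simp: adj_iff[OF v])
  then show ?case using 3 y degree_eq[OF v] by auto
qed

lemma find_unmarked_correct:
  assumes y: "input y" "y 6 7 = v" "y 6 9 = v * l"
    and p: "y 11 (Suc (z 3 (v * l + p))) \<noteq> Suc v"
      "\<And>i. i < p \<Longrightarrow> y 11 (Suc (z 3 (v * l + i))) = Suc v"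
  shows "wp find_unmarked (\<lambda>k t. k \<le> 2 * p + 1 \<and> t 6 9 = v * l + p \<and>
     (\<forall>x. x \<noteq> 9 \<longrightarrow> t 6 x = y 6 x) \<and> (\<forall>a. a \<noteq> 6 \<longrightarrow> t a = y a)) y"
  unfolding find_unmarked_def
proof (rule wp_While[where f = "\<lambda>s. 2 * (v * l + p - s 6 9)" and
    I = "\<lambda>s. v * l \<le> s 6 9 \<and> s 6 9 \<le> v * l + p \<and>
      (\<forall>x. x \<noteq> 9 \<longrightarrow> s 6 x = y 6 x) \<and> (\<forall>a. a \<noteq> 6 \<longrightarrow> s a = y a)"], goal_cases)
  case (2 s)
  have in_s: "s 3 = z 3" "s 6 7 = v" "s 11 = y 11" using 2 y by (auto simp: input_def)
  then have "s 6 9 \<noteq> v * l + p" using 2 p by auto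
  then show ?case using 2 by auto
next
  case (3 k t)
  have in_t: "t 3 = z 3" "t 6 7 = v" "t 11 = y 11" using 3 y by (auto simp: input_def)
  have "\<not> t 6 9 - v * l < p" using 3 p(2)[of "t 6 9 - v * l"] in_t by auto
  then have "t 6 9 = v * l + p" using 3 by auto
  then show ?case using 3 y by auto
qed (use y in auto)

text \<open>\<open>c\<close> and \<open>m\<close> stand for arrays 10 and 11. A free colour gives an
  unmarked position below \<open>l\<close>; \<open>p\<close> is the least one. The entries before
  \<open>p\<close> are distinct colours of neighbours of \<open>v\<close>, hence \<open>p\<close> is
  at most the degree.\<close>

lemma ex_unmarked:
  assumes S: "component_connected G S" and v: "v < n" "v \<notin> S"
    and c: "\<And>w. c w = (if w \<in> S then d w + 1 else 0)"
    and m: "\<And>x. m x = Suc v \<longleftrightarrow> (\<exists>w. {v, w} \<in> edges G \<and> c w = x)"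
  obtains p where "p < l" "p \<le> degree G v" "m (Suc (z 3 (v * l + p))) \<noteq> Suc v"
    "\<And>i. i < p \<Longrightarrow> m (Suc (z 3 (v * l + i))) = Suc v"
proof -
  have "finite (L v)" "card (L v) = max_block_degree G + 1"
    using L v V by (auto simp: list_assignment_def)
  from ex_free_colour[OF G S _ v(2) this, where c = d]
  obtain x where x: "x \<in> L v" "\<And>w. w \<in> S \<Longrightarrow> {v, w} \<in> edges G \<Longrightarrow> d w \<noteq> x"
    using v V by auto
  \<comment> \<open>Uncoloured neighbours have \<open>c\<close> equal to 0, never
    \<open>Suc x\<close>.\<close>
  have "m (Suc x) \<noteq> Suc v" using x(2) by (auto simp: m c split: if_splits)
  moreover obtain i where "i < l" "x = z 3 (v * l + i)"
    using bij_betw_imp_surj_on[OF list_bij[OF v(1)]] x(1) by auto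
  ultimately have i: "i < l" "m (Suc (z 3 (v * l + i))) \<noteq> Suc v" by auto
  define p where "p = (LEAST i. m (Suc (z 3 (v * l + i))) \<noteq> Suc v)"
  have p: "m (Suc (z 3 (v * l + p))) \<noteq> Suc v" "p \<le> i"
    unfolding p_def using i(2) by (rule LeastI, rule Least_le)
  have marked: "m (Suc (z 3 (v * l + j))) = Suc v" if "j < p" for j
    using not_less_Least[of j] that unfolding p_def by blast
  have "inj_on (\<lambda>j. z 3 (v * l + j)) {..<p}"
    using list_bij[OF v(1)] p i by (auto simp: bij_betw_def intro: inj_on_subset)
  then have "inj_on (\<lambda>j. Suc (z 3 (v * l + j))) {..<p}" by (auto simp: inj_on_def)
  moreover have "(\<lambda>j. Suc (z 3 (v * l + j))) ` {..<p} \<subseteq> c ` {w. {v, w} \<in> edges G}"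
    using marked by (force simp: m)
  ultimately have "p \<le> card (c ` {w. {v, w} \<in> edges G})"
    using card_inj_on_le[of _ "{..<p}"] finite_neighbours[OF G] by fastforce
  also have "\<dots> \<le> degree G v"
    using card_image_le[OF finite_neighbours[OF G]] card_neighbours[OF G] by metis
  finally show thesis using that[of p] p i marked by auto
qed

text \<open>The last conjunct ensures that the stamp of a vertex yet to be coloured does not occur
  in array 11.\<close>

definition coloured :: "state \<Rightarrow> bool" where
  "coloured s \<longleftrightarrow> (let S = s 7 ` {..<s 6 6} in
     (\<forall>w. s 10 w = (if w \<in> S then s 5 w + 1 else 0)) \<and> (\<forall>w\<in>S. s 5 w \<in> L w) \<and>
     (\<forall>u\<in>S. \<forall>w\<in>S. {u, w} \<in> edges G \<longrightarrow> s 5 u \<noteq> s 5 w) \<and>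
     (\<forall>x. s 11 x = 0 \<or> (\<exists>w\<in>S. s 11 x = Suc w)))"

text \<open>Marking takes at most \<open>3 * degree G v + 1\<close> steps, finding the colour at
  most \<open>2 * degree G v + 1\<close>, and six assignments remain.\<close>

lemma colour_vertex_correct:
  assumes y: "input y" "\<forall>v<n. y 9 v = v * l" "coloured y"
    and ord: "search_order G (y 7) n" "y 6 6 < n" and v: "v = y 7 (y 6 6)"
  shows "wp colour_vertex
     (\<lambda>k t. k \<le> 5 * degree G v + 8 \<and> coloured t \<and> t 6 6 = y 6 6 + 1 \<and>
       (\<forall>a. a \<notin> {5, 6, 10, 11} \<longrightarrow> t a = y a)) y"
proof -
  define S where "S = y 7 ` {..<y 6 6}"
  have S: "component_connected G S"
    unfolding S_def using ord by (intro search_order_component_connected) auto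
  have vn: "v < n" "v \<notin> S" using ord V by (auto simp: search_order_def v S_def)
  have y10: "y 10 w = (if w \<in> S then y 5 w + 1 else 0)"
    and y5: "w \<in> S \<Longrightarrow> y 5 w \<in> L w"
    and proper: "u \<in> S \<Longrightarrow> w \<in> S \<Longrightarrow> {u, w} \<in> edges G \<Longrightarrow> y 5 u \<noteq> y 5 w"
    and y11: "y 11 x = 0 \<or> (\<exists>w\<in>S. y 11 x = Suc w)" for u w x
    using y(3) unfolding coloured_def Let_def S_def by blast+
  define y1 where "y1 = y(6 := (y 6)(7 := v, 8 := z (Suc 0) v))"
  have y1: "input y1" "y1 6 7 = v" "y1 6 8 = z 1 v" using y(1) by (auto simp: y1_def input_def)
  obtain k1 t1 where e1: "exec mark_neighbours y1 k1 t1" and k1: "k1 \<le> 3 * degree G v + 1"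
    and t11: "\<And>c. t1 11 c = (if \<exists>w. {v, w} \<in> edges G \<and> y1 10 w = c then Suc v else y1 11 c)"
    and t1_6: "\<And>x. x \<noteq> 8 \<Longrightarrow> t1 6 x = y1 6 x" and t1: "\<And>a. a \<noteq> 6 \<Longrightarrow> a \<noteq> 11 \<Longrightarrow> t1 a = y1 a"
    using mark_neighbours_correct[OF y1 vn(1)] unfolding wp_def by blast
  \<comment> \<open>Old stamps belong to vertices of \<open>S\<close>, and \<open>v\<close> is not
    among them, so every stamp \<open>Suc v\<close> is fresh.\<close>
  have marked: "t1 11 x = Suc v \<longleftrightarrow> (\<exists>w. {v, w} \<in> edges G \<and> y 10 w = x)" for x
    using y11[of x] vn(2) by (auto simp: t11 y1_def)
  from ex_unmarked[OF S vn y10 marked] obtain p where p: "p < l" "p \<le> degree G v"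
    "t1 11 (Suc (z 3 (v * l + p))) \<noteq> Suc v" "\<And>i. i < p \<Longrightarrow> t1 11 (Suc (z 3 (v * l + i))) = Suc v"
    by blast
  define y2 where "y2 = t1(6 := (t1 6)(9 := v * l))"
  have y2: "input y2" "y2 6 7 = v" "y2 6 9 = v * l"
    using y1(1) by (auto simp: y2_def input_def t1 t1_6 y1_def)
  have y2_11: "y2 11 = t1 11" by (simp add: y2_def)
  have "wp find_unmarked (\<lambda>k t. k \<le> 2 * p + 1 \<and> t 6 9 = v * l + p \<and>
     (\<forall>x. x \<noteq> 9 \<longrightarrow> t 6 x = y2 6 x) \<and> (\<forall>a. a \<noteq> 6 \<longrightarrow> t a = y2 a)) y2"
    by (rule find_unmarked_correct[OF y2]) (simp_all only: y2_11 p not_False_eq_True)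
  then obtain k2 t2 where e2: "exec find_unmarked y2 k2 t2" and k2: "k2 \<le> 2 * p + 1"
    and t2_69: "t2 6 9 = v * l + p"
    and t2_6: "\<And>x. x \<noteq> 9 \<Longrightarrow> t2 6 x = y2 6 x" and t2: "\<And>a. a \<noteq> 6 \<Longrightarrow> t2 a = y2 a"
    unfolding wp_def by blast
  let ?x = "z 3 (v * l + p)"
  have x: "?x \<in> L v" using bij_betw_imp_surj_on[OF list_bij[OF vn(1)]] p(1) by auto
  have free: "y 5 w \<noteq> ?x" if "w \<in> S" "{v, w} \<in> edges G" for w
  proof
    assume "y 5 w = ?x"
    then have "y 10 w = Suc ?x" using that by (simp add: y10)
    then show False using p(3) that marked by blast
  qed
  have in_y: "y 1 = z 1" "y 2 = z 2" "y 3 = z 3" using y(1) by (auto simp: input_def)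
  let ?t = "t2(10 := (t2 10)(v := ?x + 1), 5 := (t2 5)(v := ?x), 6 := (t2 6)(6 := y 6 6 + 1))"
  have t2_simps: "t2 6 9 = v * l + p" "t2 6 7 = v" "t2 6 6 = y 6 6"
     "\<And>a. a \<noteq> 6 \<Longrightarrow> a \<noteq> 11 \<Longrightarrow> t2 a = y a" "t2 11 = t1 11"
    by (simp_all add: t2_69 t2_6 t2 t1_6 t1 y2_def y1_def)
  have im: "y 7 ` {..<Suc (y 6 6)} = insert v S" by (simp add: lessThan_Suc S_def v)
  have "?x \<noteq> y 5 w" if "w \<in> S" "{v, w} \<in> edges G" for w
    using free that by metis
  moreover have "{v} \<notin> edges G" using edge_less[of v v] by auto
  moreover have "t1 11 c = 0 \<or> (\<exists>w\<in>insert v S. t1 11 c = Suc w)" for c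
  proof -
    have "t1 11 c = Suc v \<or> t1 11 c = y 11 c" by (simp add: t11 y1_def)
    then show ?thesis using y11[of c] by auto
  qed
  ultimately have "coloured ?t"
    unfolding coloured_def Let_def
    using free x vn(2) y5 proper
    by (auto simp: t2_simps im y10 insert_commute)
  then show ?thesis
    using k1 k2 p(2) e1 e2 in_y y(2) vn(1)
    by (simp add: colour_vertex_def v[symmetric] wp_exec[OF e1[unfolded y1_def]]
        wp_exec[OF e2[unfolded y2_def]] t1 t1_6 y1_def t2_simps)
qed

text \<open>Each uncoloured vertex holds the cost of \<open>colour_vertex\<close> plus one for the
  loop test; \<open>sum_degree\<close> evaluates the total.\<close>

lemma colour_correct:
  assumes y: "input y" "\<forall>v<n. y 9 v = v * l" "y 6 6 = 0" "\<forall>x. y 10 x = 0" "\<forall>x. y 11 x = 0"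
    and ord: "search_order G (y 7) n" "y 7 ` {..<n} = {..<n}"
  shows "wp colour (\<lambda>k t. k \<le> 10 * card (edges G) + 9 * n + 1 \<and> list_coloring G L (t 5)) y"
  unfolding colour_def
proof (rule wp_While[where
    f = "\<lambda>s. \<Sum>v\<in>{..<n} - s 7 ` {..<s 6 6}. 5 * degree G v + 9" and
    I = "\<lambda>s. coloured s \<and> s 6 6 \<le> n \<and> (\<forall>a. a \<notin> {5, 6, 10, 11} \<longrightarrow> s a = y a)"], goal_cases)
  case 1
  then show ?case using y by (auto simp: coloured_def)
next
  case (2 s)
  define v where "v = s 7 (s 6 6)"
  have s: "s 7 = y 7" "input s" "s 9 = y 9" "s 6 6 < n" using 2 y n by (auto simp: input_def)
  have v: "v < n" "v \<notin> s 7 ` {..<s 6 6}"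
    using ord s V by (auto simp: search_order_def v_def)
  have im: "s 7 ` {..<Suc (s 6 6)} = insert v (s 7 ` {..<s 6 6})"
    by (simp add: lessThan_Suc v_def)
  have "{..<n} - s 7 ` {..<s 6 6} = insert v ({..<n} - insert v (s 7 ` {..<s 6 6}))"
    using v by auto
  then have sum: "(\<Sum>v\<in>{..<n} - s 7 ` {..<s 6 6}. 5 * degree G v + 9) =
      5 * degree G v + 9 + (\<Sum>v\<in>{..<n} - insert v (s 7 ` {..<s 6 6}). 5 * degree G v + 9)"
    by (metis (no_types, lifting) Diff_iff finite_Diff finite_lessThan insertI1 sum.insert)
  have "wp colour_vertex (\<lambda>k t. k \<le> 5 * degree G v + 8 \<and> coloured t \<and> t 6 6 = s 6 6 + 1 \<and>
       (\<forall>a. a \<notin> {5, 6, 10, 11} \<longrightarrow> t a = s a)) s"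
    using 2 s y(2) ord(1) by (intro colour_vertex_correct[OF s(2) _ _ _ s(4) v_def]) simp_all
  then show ?case
  proof (rule wp_mono, goal_cases)
    case (1 k t)
    then have t: "t 7 ` {..<t 6 6} = insert v (s 7 ` {..<s 6 6})" by (simp add: im)
    have "k + (\<Sum>v\<in>{..<n} - t 7 ` {..<t 6 6}. 5 * degree G v + 9) <
        (\<Sum>v\<in>{..<n} - s 7 ` {..<s 6 6}. 5 * degree G v + 9)"
      unfolding t sum using 1 by linarith
    moreover have "\<forall>a. a \<notin> {5, 6, 10, 11} \<longrightarrow> t a = y a" using 1 2 by simp
    ultimately show ?case using 1 s(4) by auto
  qed
next
  case (3 k t)
  then have "t 6 6 = n" "t 7 = y 7" using y n by (auto simp: input_def)
  then have im: "t 7 ` {..<t 6 6} = {..<n}" using ord by simp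
  have "\<forall>v\<in>{..<n}. t 5 v \<in> L v"
    "\<forall>u\<in>{..<n}. \<forall>w\<in>{..<n}. {u, w} \<in> edges G \<longrightarrow> t 5 u \<noteq> t 5 w"
    using 3 unfolding coloured_def Let_def im by blast+
  then have "list_coloring G L (t 5)" using V edge_less by (auto simp: list_coloring_def)
  moreover have "(\<Sum>v<n. 5 * degree G v + 9) = 10 * card (edges G) + 9 * n"
    using sum_degree[OF G] by (simp add: sum.distrib V flip: sum_distrib_left)
  ultimately show ?case using 3 y by auto
qed

text \<open>The three loops and the final assignment add up to at most
  \<open>26 * n + 24 * card (edges G) + 4\<close> steps.\<close>

lemma greedy_correct:
  "wp greedy (\<lambda>k t. k \<le> 30 * (card (verts G) + card (edges G) + 1) \<and>
     t 4 0 = 1 \<and> list_coloring G L (t 5)) z"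
proof -
  obtain k1 t1 where 1: "exec offsets z k1 t1" "k1 \<le> 3 * n + 1" "\<forall>v<n. t1 9 v = v * l"
    "\<forall>x>0. t1 6 x = 0" "\<forall>a. a \<noteq> 6 \<and> a \<noteq> 9 \<longrightarrow> t1 a = z a"
    using offsets_correct unfolding wp_def by blast
  have "wp search (\<lambda>k t. k \<le> 14 * card (edges G) + 14 * n + 1 \<and>
     search_order G (t 7) n \<and> t 7 ` {..<n} = {..<n} \<and> t 6 6 = 0 \<and>
     (\<forall>a. a \<noteq> 6 \<and> a \<noteq> 7 \<and> a \<noteq> 8 \<longrightarrow> t a = t1 a)) t1"
    by (rule search_correct) (use 1 in \<open>auto simp: input_def z0\<close>)
  then obtain k2 t2 where 2: "exec search t1 k2 t2" "k2 \<le> 14 * card (edges G) + 14 * n + 1"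
    "search_order G (t2 7) n" "t2 7 ` {..<n} = {..<n}" "t2 6 6 = 0"
    "\<forall>a. a \<noteq> 6 \<and> a \<noteq> 7 \<and> a \<noteq> 8 \<longrightarrow> t2 a = t1 a"
    unfolding wp_def by blast
  have "wp colour (\<lambda>k t. k \<le> 10 * card (edges G) + 9 * n + 1 \<and> list_coloring G L (t 5)) t2"
    by (rule colour_correct) (use 1 2 in \<open>auto simp: input_def z0\<close>)
  then obtain k3 t3 where 3: "exec colour t2 k3 t3" "k3 \<le> 10 * card (edges G) + 9 * n + 1"
    "list_coloring G L (t3 5)"
    unfolding wp_def by blast
  then show ?thesis using 1 2 3 V
    by (simp add: greedy_def wp_exec[OF 1(1)] wp_exec[OF 2(1)] wp_exec[OF 3(1)] z0)
qed

end

theorem proposition3p4: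
  shows "(\<forall>G :: 'a ugraph. finite_simple_graph G \<longrightarrow> choosable G (max_block_degree G + 1)) \<and>
    (\<exists>p C. solves_LISTCOL p (\<lambda>G. max_block_degree G + 1)
              (\<lambda>G. C * (card (verts G) + card (edges G) + 1)))"
proof
  have "solves_LISTCOL greedy (\<lambda>G. max_block_degree G + 1)
    (\<lambda>G. 30 * (card (verts G) + card (edges G) + 1))"
    unfolding solves_LISTCOL_def
  proof (intro allI impI, elim conjE)
    fix G L s
    assume "finite_simple_graph G" "list_assignment G (max_block_degree G + 1) L"
      "encodes G (max_block_degree G + 1) L s"
    then interpret listcol_input G "max_block_degree G + 1" L s "s 0 0"
      by unfold_locales auto
    show "\<exists>k t. exec greedy s k t \<and> k \<le> 30 * (card (verts G) + card (edges G) + 1) \<and>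
      t 4 0 = (if \<exists>c. list_coloring G L c then 1 else 0) \<and>
      ((\<exists>c. list_coloring G L c) \<longrightarrow> list_coloring G L (t 5))"
    proof -
      obtain k t where "exec greedy s k t" "k \<le> 30 * (card (verts G) + card (edges G) + 1)"
        "t 4 0 = 1" "list_coloring G L (t 5)"
        using greedy_correct unfolding wp_def by blast
      \<comment> \<open>The colouring left in array 5 itself witnesses that the instance is
        solvable, so the answer 1 is right.\<close>
      then show ?thesis by (intro exI[of _ k] exI[of _ t]) auto
    qed
  qed
  then show "\<exists>p C. solves_LISTCOL p (\<lambda>G. max_block_degree G + 1)
              (\<lambda>G. C * (card (verts G) + card (edges G) + 1))" by blast
qed (blast intro: choosable_max_block_degree)

end
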